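(* Let $n$ be a positive integer and let $D_n$ be a maximal Diophantine graph of order $n$ with Diophantine labelling $f$. Let $u,v$ be two vertices of $D_n$ such that $f(u)\mid f(v)$, $f(v)$ is not a prime power and $f^*(u)>1$. If $\deg(u)=\deg(v)$, then $f^*(u)$ and $f^*(v)$ have the same prime factors.
   Context: All graphs are finite, simple and undirected, and $(a,b)$ denotes the greatest common divisor of $a$ and $b$. A graph $G=(V,E)$ of order $n$ is a Diophantine graph if there is a bijection $f:V\to\{1,2,\dots,n\}$ (a Diophantine labelling) such that $(f(u),f(v))\mid n$ for all $uv\in E$. It is a maximal Diophantine graph, denoted $(D_n,f)$ or simply $D_n$, if adding any new edge turns it into a non-Diophantine graph; thus two distinct vertices $u,v$ of $D_n$ are adjacent if and only if $(f(u),f(v))\mid n$. The reduced label of a vertex $u$ is $f^*(u):=\frac{f(u)}{(f(u),n)}$. "Same prime factors" means the same set of prime divisors (multiplicities ignored). *)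

theory Defs
  imports "Graph_Theory.Pair_Digraph" "HOL-Number_Theory.Number_Theory"
begin

text \<open>
  Finite simple undirected graphs are symmetric loop-free digraphs (locale \<^locale>\<open>pair_graph\<close>):
  an edge \<open>uv\<close> is the pair of arcs \<open>(u, v)\<close>, \<open>(v, u)\<close>, so the degree of a vertex is its
  \<^const>\<open>out_degree\<close>.
\<close>

definition diophantine_labelling :: "'a pair_pre_digraph \<Rightarrow> ('a \<Rightarrow> nat) \<Rightarrow> bool" where
  "diophantine_labelling G f \<longleftrightarrow>
     bij_betw f (pverts G) {1..card (pverts G)} \<and>
     (\<forall>(u, v) \<in> parcs G. gcd (f u) (f v) dvd card (pverts G))"

definition diophantine_graph :: "'a pair_pre_digraph \<Rightarrow> bool" where
  "diophantine_graph G \<longleftrightarrow> pair_graph G \<and> (\<exists>f. diophantine_labelling G f)"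

definition add_edge :: "'a pair_pre_digraph \<Rightarrow> 'a \<Rightarrow> 'a \<Rightarrow> 'a pair_pre_digraph" where
  "add_edge G u v = G\<lparr>parcs := parcs G \<union> {(u, v), (v, u)}\<rparr>"

lemma pair_graph_add_edge:
  assumes "pair_graph G" "u \<in> pverts G" "v \<in> pverts G" "u \<noteq> v"
  shows "pair_graph (add_edge G u v)"
proof -
  interpret pair_graph G by fact
  have "sym (parcs G)"
    using pair_sym_arcs by (simp add: symmetric_def)
  then have "symmetric (with_proj (add_edge G u v))"
    unfolding symmetric_def by (auto simp: add_edge_def sym_def)
  then show ?thesis
    using assms pair_finite_verts pair_finite_arcs pair_no_loops
    by unfold_locales (auto simp: add_edge_def dest: in_arcsD1 in_arcsD2)
qed

text \<open>
  The labelling \<open>f\<close> is part of the data \<open>(D\<^sub>n, f)\<close>, but maximality is a property of the graph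
  alone: a graph with an added edge must admit no Diophantine labelling at all, not merely fail
  to be labelled by \<open>f\<close>.
\<close>
definition maximal_diophantine_graph :: "'a pair_pre_digraph \<Rightarrow> ('a \<Rightarrow> nat) \<Rightarrow> bool" where
  "maximal_diophantine_graph G f \<longleftrightarrow>
     pair_graph G \<and> diophantine_labelling G f \<and>
     (\<forall>u \<in> pverts G. \<forall>v \<in> pverts G.
        u \<noteq> v \<and> (u, v) \<notin> parcs G \<longrightarrow> \<not> diophantine_graph (add_edge G u v))"

definition reduced_label :: "'a pair_pre_digraph \<Rightarrow> ('a \<Rightarrow> nat) \<Rightarrow> 'a \<Rightarrow> nat" where
  "reduced_label G f u = f u div gcd (f u) (card (pverts G))"

end

(* If deg u = deg v with f u dvd f v and f u not dividing n, the inclusion N(v) <= N(u) is an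
   equality. Any prime p dividing f* v but not f* u would contradict this: the label
   p ^ (multiplicity p n + 1) divides f v, hence occurs in the graph; its gcd with f v does not
   divide n, whereas its gcd with f u is p ^ k with k <= multiplicity p n. *)
theory Submission
  imports Defs
begin

text \<open>With \<open>r = m div gcd m n\<close>, the factorization \<open>m = gcd m n * r\<close>
  makes the multiplicity of \<open>p\<close> in \<open>r\<close> that in \<open>m\<close> minus the
  minimum of those in \<open>m\<close> and \<open>n\<close>. This is positive exactly when
  \<open>m\<close> has the larger one.\<close>

lemma prime_factors_div_gcd:
  fixes m n :: nat
  assumes "m > 0" "n > 0"
  shows "prime_factors (m div gcd m n) = {p. prime p \<and> multiplicity p n < multiplicity p m}"
proof -
  define r where "r = m div gcd m n"
  have m: "m = gcd m n * r" unfolding r_def by simp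
  have r0: "r \<noteq> 0" using m assms by (metis less_numeral_extra(3) mult_0_right)
  have "p dvd r \<longleftrightarrow> multiplicity p n < multiplicity p m" if p: "prime p" for p
  proof -
    have "multiplicity p m = multiplicity p (gcd m n) + multiplicity p r"
      using p r0 assms by (subst m, subst prime_elem_multiplicity_mult_distrib) auto
    moreover have "multiplicity p (gcd m n) = min (multiplicity p m) (multiplicity p n)"
      using p assms by (intro multiplicity_gcd) auto
    moreover have "p dvd r \<longleftrightarrow> multiplicity p r > 0"
      using p r0 by (auto simp: prime_multiplicity_gt_zero_iff)
    ultimately show ?thesis by linarith
  qed
  then show ?thesis
    using r0 by (auto simp: prime_factors_dvd r_def[symmetric])
qed

text \<open>If the gcd divides the order, joining \<open>u\<close> and \<open>v\<close> leaves
  \<open>f\<close> a Diophantine labelling, so maximality forces the edge to be present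
  already.\<close>

lemma maximal_diophantine_adjacent_iff:
  assumes "maximal_diophantine_graph D f"
    and "u \<in> pverts D" "v \<in> pverts D" "u \<noteq> v"
  shows "(u, v) \<in> parcs D \<longleftrightarrow> gcd (f u) (f v) dvd card (pverts D)"
proof
  have lab: "diophantine_labelling D f"
    using assms(1) by (simp add: maximal_diophantine_graph_def)
  show "gcd (f u) (f v) dvd card (pverts D)" if "(u, v) \<in> parcs D"
    using lab that by (auto simp: diophantine_labelling_def)
  show "(u, v) \<in> parcs D" if dvd: "gcd (f u) (f v) dvd card (pverts D)"
  proof (rule ccontr)
    assume "(u, v) \<notin> parcs D"
    then have "\<not> diophantine_graph (add_edge D u v)"
      using assms by (auto simp: maximal_diophantine_graph_def)
    moreover have "pair_graph (add_edge D u v)"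
      using assms by (intro pair_graph_add_edge) (auto simp: maximal_diophantine_graph_def)
    moreover have "diophantine_labelling (add_edge D u v) f"
      using lab dvd by (auto simp: diophantine_labelling_def add_edge_def gcd.commute)
    ultimately show False by (auto simp: diophantine_graph_def)
  qed
qed

text \<open>The labelling carries the neighbours of \<open>w\<close> bijectively to labels, which
  turns degrees into counts of integers. The set on the right leaves out the label of
  \<open>w\<close> itself, as it must in a loop-free graph, because
  \<open>gcd (f w) (f w) = f w\<close> does not divide the order.\<close>

lemma out_degree_maximal_diophantine:
  assumes D: "maximal_diophantine_graph D f"
    and w: "w \<in> pverts D" and nd: "\<not> f w dvd card (pverts D)"
  shows "out_degree (with_proj D) w =
    card {x \<in> {1..card (pverts D)}. gcd (f w) x dvd card (pverts D)}"
proof -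
  let ?n = "card (pverts D)"
  interpret pair_graph D
    using D by (simp add: maximal_diophantine_graph_def)
  have bij: "bij_betw f (pverts D) {1..?n}"
    using D by (simp add: maximal_diophantine_graph_def diophantine_labelling_def)
  have arc: "(w, z) \<in> parcs D \<longleftrightarrow> z \<in> pverts D \<and> gcd (f w) (f z) dvd ?n" for z
  proof (cases "z = w")
    case True
    then show ?thesis using nd pair_no_loops by fastforce
  next
    case False
    then show ?thesis
      using maximal_diophantine_adjacent_iff[OF D w] in_arcsD2 by blast
  qed
  have "out_arcs (with_proj D) w = Pair w ` {z \<in> pverts D. gcd (f w) (f z) dvd ?n}"
    using arc by (auto simp: out_arcs_def)
  then have "out_degree (with_proj D) w = card {z \<in> pverts D. gcd (f w) (f z) dvd ?n}"
    by (simp add: out_degree_def card_image inj_on_def)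
  also have "\<dots> = card (f ` {z \<in> pverts D. gcd (f w) (f z) dvd ?n})"
    using bij by (intro card_image[symmetric]) (auto simp: bij_betw_def inj_on_def)
  also have "f ` {z \<in> pverts D. gcd (f w) (f z) dvd ?n} = {x \<in> {1..?n}. gcd (f w) x dvd ?n}"
    using bij_betw_imp_surj_on[OF bij] by auto
  finally show ?thesis .
qed

theorem theorem4p7:
  fixes D :: "'a pair_pre_digraph" and f :: "'a \<Rightarrow> nat" and n :: nat and u v :: 'a
  assumes "n > 0"
    and "maximal_diophantine_graph D f"
    and "card (pverts D) = n"
    and "u \<in> pverts D" and "v \<in> pverts D"
    and "f u dvd f v"
    and "\<not> primepow (f v)"
    and "reduced_label D f u > 1"
    and "out_degree (with_proj D) u = out_degree (with_proj D) v"
  shows "prime_factors (reduced_label D f u) = prime_factors (reduced_label D f v)"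
proof -
  have "f ` pverts D = {1..n}"
    using assms(2,3)
    by (auto simp: maximal_diophantine_graph_def diophantine_labelling_def bij_betw_def)
  then have pos: "f u > 0" "f v > 0" and le: "f v \<le> n"
    using assms(4,5) by (force simp: set_eq_iff)+
  \<comment> \<open>Otherwise \<open>gcd (f u) n = f u\<close> and the reduced label would be
    1.\<close>
  have ndu: "\<not> f u dvd n"
    using assms(3,8) pos by (auto simp: reduced_label_def gcd_nat.absorb1)
  then have ndv: "\<not> f v dvd n"
    using assms(6) dvd_trans by blast
  let ?N = "\<lambda>m. {x \<in> {1..n}. gcd m x dvd n}"
  \<comment> \<open>For every \<open>x\<close>, \<open>gcd (f u) x\<close> divides
    \<open>gcd (f v) x\<close>.\<close>
  have "?N (f v) \<subseteq> ?N (f u)"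
    using gcd_mono[OF assms(6) dvd_refl] dvd_trans by blast
  moreover have "card (?N (f u)) = card (?N (f v))"
    using out_degree_maximal_diophantine[OF assms(2,4)]
      out_degree_maximal_diophantine[OF assms(2,5)] ndu ndv assms(3,9) by simp
  ultimately have N: "?N (f v) = ?N (f u)"
    by (intro card_subset_eq) auto
  \<comment> \<open>By \<open>prime_factors_div_gcd\<close>, the two sides say that \<open>p\<close>
    divides the reduced label of \<open>u\<close> and of \<open>v\<close> respectively.\<close>
  have "multiplicity p n < multiplicity p (f u) \<longleftrightarrow> multiplicity p n < multiplicity p (f v)"
    if p: "prime p" for p
  proof
    show "multiplicity p n < multiplicity p (f v)" if "multiplicity p n < multiplicity p (f u)"
      using that dvd_imp_multiplicity_le[OF assms(6), of p] pos by simp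
    assume less: "multiplicity p n < multiplicity p (f v)"
    \<comment> \<open>The least power of \<open>p\<close> that does not divide \<open>n\<close>. It
      divides \<open>f v\<close>, so it is at most \<open>n\<close> and is itself a label.\<close>
    define q where "q = p ^ Suc (multiplicity p n)"
    have qv: "q dvd f v"
      unfolding q_def using less by (intro multiplicity_dvd') auto
    have qn: "\<not> q dvd n"
      unfolding q_def using p assms(1) power_dvd_iff_le_multiplicity[of n p "Suc (multiplicity p n)"]
      by (auto dest: prime_gt_1_nat simp del: power_Suc)
    have "q \<in> {1..n}"
      using dvd_imp_le[OF qv] pos le prime_gt_0_nat[OF p] by (simp add: q_def Suc_leI)
    moreover have "gcd (f v) q = q"
      using qv by (simp add: gcd_nat.absorb2)
    \<comment> \<open>Since \<open>gcd (f v) q = q\<close> does not divide \<open>n\<close>, the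
      label \<open>q\<close> lies outside \<open>?N (f v)\<close>, hence outside
      \<open>?N (f u)\<close>.\<close>
    ultimately have nd: "\<not> gcd (f u) q dvd n"
      using N qn by (metis (mono_tags, lifting) mem_Collect_eq)
    show "multiplicity p n < multiplicity p (f u)"
    proof (rule ccontr)
      assume le_mult: "\<not> ?thesis"
      \<comment> \<open>A divisor of a power of \<open>p\<close> is a power of \<open>p\<close>. As
        it also divides \<open>f u\<close>, its exponent is bounded by the multiplicity of
        \<open>p\<close> in \<open>f u\<close>, and by \<open>le_mult\<close> by that in
        \<open>n\<close>.\<close>
      obtain k where k: "gcd (f u) q = p ^ k"
        using divides_primepow_nat[OF p, of "gcd (f u) q" "Suc (multiplicity p n)"]
        by (auto simp: q_def)
      then have "p ^ k dvd f u" by (metis gcd_dvd1)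
      then have "k \<le> multiplicity p (f u)"
        using p pos by (intro multiplicity_geI) (auto simp: not_prime_unit)
      then have "p ^ k dvd n"
        using le_mult by (intro multiplicity_dvd') auto
      then show False using nd k by simp
    qed
  qed
  then show ?thesis
    using prime_factors_div_gcd[OF pos(1) assms(1)] prime_factors_div_gcd[OF pos(2) assms(1)]
    by (auto simp: reduced_label_def assms(3))
qed

end
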